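(* Let $\delta\in(0,1/4)$ and $\epsilon_{\max}\in(0,1/2)$ be fixed constants. There is a constant $c>0$ depending only on $\delta$ and $\epsilon_{\max}$ such that the following two assertions hold. 1. Suppose $\sigma^2>0$ is known. For any adaptive confidence interval $\widehat{\mathrm{CI}}$ (computed from $n$ i.i.d. observations, possibly using $\sigma$ but not $\varepsilon$) and any length function $r=r(n,\sigma,\varepsilon)$ that satisfy $$\inf_{\theta\in\mathbb R}\ \inf_{\varepsilon\in[0,\epsilon_{\max}],\,Q}\Big(P^{(\mathrm{Huber})}_{\theta,\sigma,\varepsilon,Q}\Big)^n\big(\theta\in\widehat{\mathrm{CI}}\big)\ge1-\delta,\qquad \inf_{\theta\in\mathbb R}\ \inf_{\varepsilon\in[0,\epsilon_{\max}],\,Q}\Big(P^{(\mathrm{Efron})}_{\theta,\sigma,\varepsilon,Q}\Big)^n\big(|\widehat{\mathrm{CI}}|\le r\big)\ge1-\delta,$$ it must hold that $r(n,\sigma,\varepsilon)\ge c\,\sigma/\sqrt{\log n}$ for all $(n,\sigma,\varepsilon)$ with $n\ge 2$ and $\varepsilon\in[0,\epsilon_{\max}]$. 2. Suppose $\sigma^2>0$ is unknown. For any adaptive confidence interval $\widehat{\mathrm{CI}}$ (computed from $n$ i.i.d. observations, using neither $\sigma$ nor $\varepsilon$) and any length function $r=r(n,\sigma,\varepsilon)$ that satisfy $$\inf_{\theta\in\mathbb R,\,\sigma^2>0}\ \inf_{\varepsilon\in[0,\epsilon_{\max}],\,Q}\Big(P^{(\mathrm{Huber})}_{\theta,\sigma,\varepsilon,Q}\Big)^n\big(\theta\in\widehat{\mathrm{CI}}\big)\ge1-\delta,\qquad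 \inf_{\theta\in\mathbb R,\,\sigma^2>0}\ \inf_{\varepsilon\in[0,\epsilon_{\max}],\,Q}\Big(P^{(\mathrm{Efron})}_{\theta,\sigma,\varepsilon,Q}\Big)^n\big(|\widehat{\mathrm{CI}}|\le r\big)\ge1-\delta,$$ it must hold that $r(n,\sigma,\varepsilon)\ge c\,\sigma$ for all $(n,\sigma,\varepsilon)$ with $\varepsilon\in[0,\epsilon_{\max}]$.
   Context: For $I\subseteq\mathbb R$, $|I|=\sup I-\inf I$ denotes its diameter (length). For $\theta\in\mathbb R$, $\sigma>0$, $\varepsilon\in[0,1/2)$ and $Q$ an arbitrary probability distribution on $\mathbb R$, $$P^{(\mathrm{Huber})}_{\theta,\sigma,\varepsilon,Q}=(1-\varepsilon)\,\mathcal N(\theta,\sigma^2)+\varepsilon\,Q,\qquad P^{(\mathrm{Efron})}_{\theta,\sigma,\varepsilon,Q}=(1-\varepsilon)\,\mathcal N(\theta,\sigma^2)+\varepsilon\,Q*\mathcal N(0,\sigma^2),$$ and $(P)^n$ denotes the law of $n$ i.i.d. observations from $P$. Infima over $Q$ range over all probability distributions on $\mathbb R$. *)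

theory Defs
  imports "HOL-Probability.Probability"
begin

abbreviation prob_dists :: "real measure set" where
  "prob_dists \<equiv> space (prob_algebra borel)"

definition normal :: "real \<Rightarrow> real \<Rightarrow> real measure" where
  "normal \<theta> \<sigma> = density lborel (\<lambda>x. ennreal (normal_density \<theta> \<sigma> x))"

definition mixture :: "real \<Rightarrow> real measure \<Rightarrow> real measure \<Rightarrow> real measure" where
  "mixture \<epsilon> P Q = measure_of UNIV (sets borel)
     (\<lambda>A. ennreal (1 - \<epsilon>) * emeasure P A + ennreal \<epsilon> * emeasure Q A)"

definition huber :: "real \<Rightarrow> real \<Rightarrow> real \<Rightarrow> real measure \<Rightarrow> real measure" where
  "huber \<theta> \<sigma> \<epsilon> Q = mixture \<epsilon> (normal \<theta> \<sigma>) Q"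

definition efron :: "real \<Rightarrow> real \<Rightarrow> real \<Rightarrow> real measure \<Rightarrow> real measure" where
  "efron \<theta> \<sigma> \<epsilon> Q = mixture \<epsilon> (normal \<theta> \<sigma>) (Q \<star> normal 0 \<sigma>)"

(* Probability that n i.i.d. draws from P satisfy E. A non-measurable event gets the value 0,
   so a positive lower bound on this quantity includes measurability of the event. *)
definition iid_prob :: "nat \<Rightarrow> real measure \<Rightarrow> ((nat \<Rightarrow> real) \<Rightarrow> bool) \<Rightarrow> ennreal" where
  "iid_prob n P E =
     emeasure (Pi\<^sub>M {..<n} (\<lambda>_. P)) {x \<in> space (Pi\<^sub>M {..<n} (\<lambda>_. P)). E x}"

(* Extended-real valued, so that unbounded intervals have length infinity;
   the empty interval has length 0. *)
definition len :: "real set \<Rightarrow> ereal" where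
  "len I = (if I = {} then 0 else (SUP x\<in>I. ereal x) - (INF x\<in>I. ereal x))"

(* A sample of size n is a function in the extensional product, so an interval estimator
   is a function of the n observations only. *)
definition interval_estimator :: "nat \<Rightarrow> ((nat \<Rightarrow> real) \<Rightarrow> real set) \<Rightarrow> bool" where
  "interval_estimator n CI \<longleftrightarrow> (\<forall>x \<in> {..<n} \<rightarrow>\<^sub>E UNIV. is_interval (CI x))"

lemma prob_dists_iff: "Q \<in> prob_dists \<longleftrightarrow> prob_space Q \<and> sets Q = sets borel"
  by (auto simp: space_prob_algebra)

lemma normal_prob_dist: "\<sigma> > 0 \<Longrightarrow> normal \<theta> \<sigma> \<in> prob_dists"
  unfolding prob_dists_iff normal_def using prob_space_normal_density by simp

lemma sets_mixture: "sets (mixture \<epsilon> P Q) = sets borel"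
  by (simp add: mixture_def sets.sigma_sets_eq[of borel, simplified])

lemma emeasure_mixture:
  assumes "P \<in> prob_dists" "Q \<in> prob_dists" "A \<in> sets borel"
  shows "emeasure (mixture \<epsilon> P Q) A = ennreal (1 - \<epsilon>) * emeasure P A + ennreal \<epsilon> * emeasure Q A"
  unfolding mixture_def
proof (rule emeasure_measure_of_sigma[OF _ _ _ assms(3)])
  show "sigma_algebra UNIV (sets (borel :: real measure))"
    by (metis sets.sigma_algebra_axioms space_borel)
  show "positive (sets borel) (\<lambda>A. ennreal (1 - \<epsilon>) * emeasure P A + ennreal \<epsilon> * emeasure Q A)"
    by (simp add: positive_def)
  show "countably_additive (sets borel)
      (\<lambda>A. ennreal (1 - \<epsilon>) * emeasure P A + ennreal \<epsilon> * emeasure Q A)"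
  proof (rule countably_additiveI)
    fix F :: "nat \<Rightarrow> real set"
    assume F: "range F \<subseteq> sets borel" "disjoint_family F"
    have sP: "sets P = sets borel" and sQ: "sets Q = sets borel"
      using assms by (auto simp: prob_dists_iff)
    have "(\<Sum>i. ennreal (1 - \<epsilon>) * emeasure P (F i) + ennreal \<epsilon> * emeasure Q (F i)) =
        ennreal (1 - \<epsilon>) * (\<Sum>i. emeasure P (F i)) + ennreal \<epsilon> * (\<Sum>i. emeasure Q (F i))"
      by (simp add: suminf_add[symmetric] summableI)
    then show "(\<Sum>i. ennreal (1 - \<epsilon>) * emeasure P (F i) + ennreal \<epsilon> * emeasure Q (F i)) =
        ennreal (1 - \<epsilon>) * emeasure P (\<Union>i. F i) + ennreal \<epsilon> * emeasure Q (\<Union>i. F i)"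
      using F sP sQ by (simp add: suminf_emeasure)
  qed
qed

lemma mixture_prob_dist:
  assumes "P \<in> prob_dists" "Q \<in> prob_dists" "\<epsilon> \<in> {0..1}"
  shows "mixture \<epsilon> P Q \<in> prob_dists"
proof -
  have "emeasure P UNIV = 1" "emeasure Q UNIV = 1"
    using assms by (metis prob_dists_iff prob_space.emeasure_space_1 sets_eq_imp_space_eq space_borel)+
  then have "emeasure (mixture \<epsilon> P Q) UNIV = 1"
    using assms by (simp add: emeasure_mixture flip: ennreal_plus)
  moreover have "space (mixture \<epsilon> P Q) = UNIV"
    using sets_eq_imp_space_eq[OF sets_mixture] by simp
  ultimately show ?thesis
    by (auto simp: prob_dists_iff sets_mixture intro!: prob_spaceI)
qed

lemma convolution_prob_dist:
  assumes "P \<in> prob_dists" "Q \<in> prob_dists"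
  shows "(P \<star> Q) \<in> prob_dists"
proof -
  interpret P: prob_space P using assms by (simp add: prob_dists_iff)
  interpret Q: prob_space Q using assms by (simp add: prob_dists_iff)
  interpret PQ: pair_prob_space P Q ..
  have [measurable_cong]: "sets P = sets borel" "sets Q = sets borel"
    using assms by (simp_all add: prob_dists_iff)
  have "prob_space (P \<star> Q)"
    unfolding convolution_def by (rule PQ.prob_space_distr) measurable
  then show ?thesis
    by (simp add: prob_dists_iff)
qed

lemma huber_prob_dist:
  "\<sigma> > 0 \<Longrightarrow> \<epsilon> \<in> {0..1} \<Longrightarrow> Q \<in> prob_dists \<Longrightarrow> huber \<theta> \<sigma> \<epsilon> Q \<in> prob_dists"
  unfolding huber_def by (intro mixture_prob_dist normal_prob_dist)

lemma efron_prob_dist: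
  "\<sigma> > 0 \<Longrightarrow> \<epsilon> \<in> {0..1} \<Longrightarrow> Q \<in> prob_dists \<Longrightarrow> efron \<theta> \<sigma> \<epsilon> Q \<in> prob_dists"
  unfolding efron_def by (intro mixture_prob_dist normal_prob_dist convolution_prob_dist)

end

theory Submission
  imports Defs
begin

text \<open>
  Both assertions rest on one two-point argument. Efron's model contains the uncontaminated law
  \<open>N(0,\<sigma>\<^sup>2)\<close> for every contamination level, so the interval must have length at most
  \<open>r n \<sigma> \<epsilon>\<close> under i.i.d. normal data, whichever \<open>\<epsilon>\<close> is inserted. But up to a small error the
  same normal data can also be produced by a Huber model centred at some \<open>\<theta> > 0\<close> with contamination
  \<open>\<epsilon>max\<close>, and the interval must cover \<open>\<theta>\<close> there. Hence under \<open>N(0,\<sigma>\<^sup>2)\<^sup>n\<close> it covers \<open>0\<close> and is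
  short, each with probability at least \<open>1 - \<delta>\<close>, and it covers \<open>\<theta>\<close> with a probability that is smaller
  by at most the error. As \<open>\<delta> < 1/4\<close>, the three events meet if the error is at most \<open>1/4\<close>, and
  \<open>r n \<sigma> \<epsilon> \<ge> \<theta>\<close> follows (lemma \<open>confidence_length_ge\<close>).

  The adversary turns a density \<open>f\<close> into an approximation of a density \<open>p\<close> by choosing a
  contamination proportional to the positive part of \<open>p - (1-\<epsilon>) f\<close>. What cannot be repaired is the
  mass where \<open>(1-\<epsilon>) f\<close> exceeds \<open>p\<close>: the per-observation error is the integral of the positive part
  of \<open>(1-\<epsilon>) f - p\<close> (lemma \<open>exists_contamination\<close>), and errors add up over the \<open>n\<close> observations
  (lemma \<open>nn_integral_PiM_le_add\<close>). It remains to see how far away \<open>\<theta>\<close> may be.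

  If \<open>\<sigma>\<close> is unknown, the adversary may use a slightly smaller standard deviation. Then \<open>f\<close> has
  lighter tails than \<open>p\<close>, and \<open>(1-\<epsilon>) f \<le> p\<close> holds everywhere for a shift \<open>\<theta>\<close> of order \<open>\<sigma>\<close>:
  the imitation is perfect for every \<open>n\<close> (lemma \<open>narrow_normal_density_le\<close>).

  If \<open>\<sigma>\<close> is known, the likelihood ratio of \<open>N(\<theta>,\<sigma>\<^sup>2)\<close> and \<open>N(0,\<sigma>\<^sup>2)\<close> is unbounded, but
  it exceeds \<open>1/(1-\<epsilon>)\<close> only beyond a point of order \<open>\<sigma>\<^sup>2/\<theta>\<close>. For \<open>\<theta>\<close> of order \<open>\<sigma> / sqrt (ln n)\<close> with
  a small constant the normal mass beyond that point is smaller than a high power of \<open>1/n\<close>, which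
  a Chernoff bound makes precise (lemma \<open>shift_excess_le\<close>).
\<close>

section \<open>Approximate domination of product measures\<close>

text \<open>
  Replacing one factor \<open>P\<close> by \<open>Q\<close> costs \<open>\<tau>\<close>. Stating the bound for functions rather than for events
  makes the induction work: integrating out the replaced coordinate yields another function
  bounded by \<open>1\<close>, not an indicator.
\<close>

lemma nn_integral_PiM_le_add:
  fixes P Q :: "'a measure"
  assumes P: "prob_space P" and Q: "prob_space Q" and sets: "sets P = sets Q"
  assumes dom: "\<And>g. g \<in> borel_measurable Q \<Longrightarrow> (\<And>x. g x \<le> 1) \<Longrightarrow>
    (\<integral>\<^sup>+x. g x \<partial>P) \<le> (\<integral>\<^sup>+x. g x \<partial>Q) + \<tau>"
  assumes f: "f \<in> borel_measurable (Pi\<^sub>M {..<n} (\<lambda>_. Q))" "\<And>x. f x \<le> 1"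
  shows "(\<integral>\<^sup>+x. f x \<partial>Pi\<^sub>M {..<n} (\<lambda>_. P)) \<le> (\<integral>\<^sup>+x. f x \<partial>Pi\<^sub>M {..<n} (\<lambda>_. Q)) + of_nat n * \<tau>"
  using f
proof (induction n arbitrary: f)
  case 0
  show ?case by (simp add: nn_integral_empty PiM_empty)
next
  case (Suc n)
  interpret P: prob_space P by fact
  interpret Q: prob_space Q by fact
  interpret PP: product_prob_space "\<lambda>_::nat. P" by standard
  interpret QQ: product_prob_space "\<lambda>_::nat. Q" by standard
  interpret Pn: prob_space "Pi\<^sub>M {..<n} (\<lambda>_. P)"
    by (rule prob_space_PiM) (rule P)
  note [measurable_cong] = sets
  have ins: "{..<Suc n} = insert n {..<n}" by auto
  have [measurable]: "f \<in> borel_measurable (Pi\<^sub>M (insert n {..<n}) (\<lambda>_. Q))"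
    using Suc.prems(1) by (simp add: ins)
  have sets_n: "sets (Pi\<^sub>M I (\<lambda>_. P)) = sets (Pi\<^sub>M I (\<lambda>_. Q))" for I :: "nat set"
    by (intro sets_PiM_cong sets refl)
  note [measurable_cong] = sets_n
  have fP: "f \<in> borel_measurable (Pi\<^sub>M (insert n {..<n}) (\<lambda>_. P))"
    by measurable
  have pair: "(\<lambda>z. f ((fst z)(n := snd z))) \<in> borel_measurable (Pi\<^sub>M {..<n} (\<lambda>_. Q) \<Otimes>\<^sub>M Q)"
    by measurable
  define g where "g x = (\<integral>\<^sup>+y. f (x(n := y)) \<partial>Q)" for x
  have g[measurable]: "g \<in> borel_measurable (Pi\<^sub>M {..<n} (\<lambda>_. Q))"
    unfolding g_def by measurable
  have g1: "g x \<le> 1" for x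
  proof -
    have "g x \<le> (\<integral>\<^sup>+y. 1 \<partial>Q)"
      unfolding g_def by (intro nn_integral_mono Suc.prems(2))
    then show ?thesis by (simp add: Q.emeasure_space_1)
  qed
  have "(\<integral>\<^sup>+x. f x \<partial>Pi\<^sub>M {..<Suc n} (\<lambda>_. P)) =
      (\<integral>\<^sup>+x. (\<integral>\<^sup>+y. f (x(n := y)) \<partial>P) \<partial>Pi\<^sub>M {..<n} (\<lambda>_. P))"
    unfolding ins by (rule PP.product_nn_integral_insert[OF _ _ fP]) auto
  also have "\<dots> \<le> (\<integral>\<^sup>+x. g x + \<tau> \<partial>Pi\<^sub>M {..<n} (\<lambda>_. P))"
  proof (rule nn_integral_mono)
    fix x assume "x \<in> space (Pi\<^sub>M {..<n} (\<lambda>_. P))"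
    then have "x \<in> space (Pi\<^sub>M {..<n} (\<lambda>_. Q))"
      using sets_eq_imp_space_eq[OF sets_n] by simp
    then have "(\<lambda>y. f (x(n := y))) \<in> borel_measurable Q"
      using measurable_compose[OF measurable_Pair1' pair] by simp
    then show "(\<integral>\<^sup>+y. f (x(n := y)) \<partial>P) \<le> g x + \<tau>"
      unfolding g_def by (rule dom) (rule Suc.prems(2))
  qed
  also have "\<dots> = (\<integral>\<^sup>+x. g x \<partial>Pi\<^sub>M {..<n} (\<lambda>_. P)) + \<tau>"
    by (subst nn_integral_add) (auto simp: Pn.emeasure_space_1)
  also have "\<dots> \<le> (\<integral>\<^sup>+x. g x \<partial>Pi\<^sub>M {..<n} (\<lambda>_. Q)) + of_nat n * \<tau> + \<tau>"
    by (intro add_right_mono Suc.IH g g1)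
  also have "(\<integral>\<^sup>+x. g x \<partial>Pi\<^sub>M {..<n} (\<lambda>_. Q)) = (\<integral>\<^sup>+x. f x \<partial>Pi\<^sub>M {..<Suc n} (\<lambda>_. Q))"
    unfolding ins g_def by (rule QQ.product_nn_integral_insert[symmetric]) auto
  finally show ?case
    by (simp add: algebra_simps)
qed

lemma iid_prob_le_add:
  assumes P: "P \<in> prob_dists" and Q: "Q \<in> prob_dists"
  assumes dom: "\<And>g. g \<in> borel_measurable borel \<Longrightarrow> (\<And>x. g x \<le> 1) \<Longrightarrow>
    (\<integral>\<^sup>+x. g x \<partial>P) \<le> (\<integral>\<^sup>+x. g x \<partial>Q) + \<tau>"
  shows "iid_prob n P E \<le> iid_prob n Q E + of_nat n * \<tau>"
proof -
  have sP: "sets P = sets borel" "prob_space P" and sQ: "sets Q = sets borel" "prob_space Q"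
    using P Q by (auto simp: prob_dists_iff)
  have sets_n: "sets (Pi\<^sub>M {..<n} (\<lambda>_. P)) = sets (Pi\<^sub>M {..<n} (\<lambda>_. Q))"
    by (intro sets_PiM_cong) (auto simp: sP sQ)
  have mb: "borel_measurable Q = borel_measurable borel"
    by (intro measurable_cong_sets) (auto simp: sQ)
  define A where "A = {x \<in> space (Pi\<^sub>M {..<n} (\<lambda>_. P)). E x}"
  have AQ: "A = {x \<in> space (Pi\<^sub>M {..<n} (\<lambda>_. Q)). E x}"
    using sets_eq_imp_space_eq[OF sets_n] by (simp add: A_def)
  show ?thesis
  proof (cases "A \<in> sets (Pi\<^sub>M {..<n} (\<lambda>_. Q))")
    case True
    have "(\<integral>\<^sup>+x. indicator A x \<partial>Pi\<^sub>M {..<n} (\<lambda>_. P)) \<le>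
        (\<integral>\<^sup>+x. indicator A x \<partial>Pi\<^sub>M {..<n} (\<lambda>_. Q)) + of_nat n * \<tau>"
    proof (rule nn_integral_PiM_le_add)
      show "prob_space P" "prob_space Q" "sets P = sets Q" using sP sQ by auto
      show "(\<integral>\<^sup>+x. g x \<partial>P) \<le> (\<integral>\<^sup>+x. g x \<partial>Q) + \<tau>"
        if "g \<in> borel_measurable Q" "\<And>x. g x \<le> 1" for g
        using dom that mb by blast
      show "indicator A \<in> borel_measurable (Pi\<^sub>M {..<n} (\<lambda>_. Q))" using True by simp
      show "indicator A x \<le> (1::ennreal)" for x by (simp add: indicator_def)
    qed
    then show ?thesis
      using True sets_n by (simp add: iid_prob_def A_def[symmetric] AQ[symmetric])
  next
    case False
    then show ?thesis
      using sets_n by (simp add: iid_prob_def A_def[symmetric] emeasure_notin_sets)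
  qed
qed

section \<open>The least favourable contamination\<close>

lemma nn_integral_density_lborel:
  assumes "f \<in> borel_measurable borel" "g \<in> borel_measurable borel"
  shows "(\<integral>\<^sup>+x. g x \<partial>density lborel f) = (\<integral>\<^sup>+x. f x * g x \<partial>lborel)"
  using assms by (intro nn_integral_density) auto

text \<open>
  The contamination has density proportional to the positive part \<open>u\<close> of \<open>p - (1-\<epsilon>) f\<close>. Its total
  mass \<open>Z\<close> is at least \<open>\<epsilon>\<close>, so after normalisation and weighting by \<open>\<epsilon>\<close> it does not exceed \<open>u\<close>,
  and the mixture has a density below \<open>max p ((1-\<epsilon>) f)\<close>.
\<close>

lemma exists_contamination:
  fixes f p :: "real \<Rightarrow> real"
  assumes [measurable]: "f \<in> borel_measurable borel" "p \<in> borel_measurable borel"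
  assumes nonneg: "\<And>x. 0 \<le> f x" "\<And>x. 0 \<le> p x"
  assumes f1: "(\<integral>\<^sup>+x. f x \<partial>lborel) = 1" and p1: "(\<integral>\<^sup>+x. p x \<partial>lborel) = 1"
  assumes \<epsilon>: "0 < \<epsilon>" "\<epsilon> < 1"
  obtains Q where "Q \<in> prob_dists"
    and "\<And>g. g \<in> borel_measurable borel \<Longrightarrow> (\<And>x. g x \<le> 1) \<Longrightarrow>
      (\<integral>\<^sup>+x. g x \<partial>mixture \<epsilon> (density lborel f) Q) \<le>
      (\<integral>\<^sup>+x. g x \<partial>density lborel p) + (\<integral>\<^sup>+x. ennreal ((1 - \<epsilon>) * f x - p x) \<partial>lborel)"
proof -
  define u where "u x = ennreal (p x - (1 - \<epsilon>) * f x)" for x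
  define Z where "Z = (\<integral>\<^sup>+x. u x \<partial>lborel)"
  define Q where "Q = density lborel (\<lambda>x. u x / Z)"
  define m where "m x = ennreal (1 - \<epsilon>) * ennreal (f x) + ennreal \<epsilon> * (u x / Z)" for x
  have [measurable]: "u \<in> borel_measurable borel" unfolding u_def by measurable
  have [measurable]: "m \<in> borel_measurable borel" unfolding m_def by measurable
  have "1 \<le> (\<integral>\<^sup>+x. ennreal (1 - \<epsilon>) * ennreal (f x) + u x \<partial>lborel)"
    unfolding p1[symmetric] u_def using \<epsilon> nonneg
    by (intro nn_integral_mono) (simp add: ennreal_mult[symmetric] ennreal_plus_if ennreal_leI)
  also have "\<dots> = ennreal (1 - \<epsilon>) + Z"
    by (simp add: nn_integral_add nn_integral_cmult f1 Z_def)
  finally have Z_lower: "ennreal \<epsilon> \<le> Z"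
    using \<epsilon> by (cases Z) (simp_all add: ennreal_plus[symmetric] ennreal_1[symmetric] del: ennreal_plus ennreal_1)
  have "Z \<le> 1"
    unfolding p1[symmetric] u_def Z_def using \<epsilon> nonneg
    by (intro nn_integral_mono ennreal_leI) simp
  then have Z: "Z \<noteq> 0" "Z \<noteq> \<top>"
    using Z_lower \<epsilon> by (auto simp: top_unique)
  have "emeasure Q UNIV = 1"
    using Z by (simp add: Q_def emeasure_density nn_integral_divide Z_def[symmetric] ennreal_divide_self less_top)
  then have Q: "Q \<in> prob_dists"
    by (auto simp: prob_dists_iff Q_def intro!: prob_spaceI)
  have F: "density lborel f \<in> prob_dists"
    by (auto simp: prob_dists_iff emeasure_density f1 intro!: prob_spaceI)
  have mix: "mixture \<epsilon> (density lborel f) Q = density lborel m"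
  proof (rule measure_eqI)
    show "sets (mixture \<epsilon> (density lborel f) Q) = sets (density lborel m)"
      by (simp add: sets_mixture)
  next
    fix A assume "A \<in> sets (mixture \<epsilon> (density lborel f) Q)"
    then have [measurable]: "A \<in> sets borel" by (simp add: sets_mixture)
    have "emeasure (mixture \<epsilon> (density lborel f) Q) A =
        ennreal (1 - \<epsilon>) * (\<integral>\<^sup>+x. ennreal (f x) * indicator A x \<partial>lborel) +
        ennreal \<epsilon> * (\<integral>\<^sup>+x. (u x / Z) * indicator A x \<partial>lborel)"
      by (subst emeasure_mixture[OF F Q]) (simp_all add: Q_def emeasure_density)
    also have "\<dots> = (\<integral>\<^sup>+x. ennreal (1 - \<epsilon>) * (ennreal (f x) * indicator A x) +
        ennreal \<epsilon> * ((u x / Z) * indicator A x) \<partial>lborel)"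
      by (subst nn_integral_add) (simp_all add: nn_integral_cmult)
    also have "\<dots> = (\<integral>\<^sup>+x. m x * indicator A x \<partial>lborel)"
      by (intro nn_integral_cong) (simp add: m_def distrib_right mult.assoc)
    finally show "emeasure (mixture \<epsilon> (density lborel f) Q) A = emeasure (density lborel m) A"
      by (simp add: emeasure_density)
  qed
  have m_le: "m x \<le> ennreal (p x) + ennreal ((1 - \<epsilon>) * f x - p x)" for x
  proof -
    have "ennreal \<epsilon> * (u x / Z) \<le> Z * (u x / Z)"
      by (intro mult_right_mono Z_lower) simp
    also have "\<dots> = u x"
      using Z by (simp add: ennreal_times_divide mult.commute[of Z] mult_divide_eq_ennreal)
    finally have "m x \<le> ennreal ((1 - \<epsilon>) * f x) + u x"
      using \<epsilon> nonneg by (simp add: m_def ennreal_mult)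
    also have "\<dots> = ennreal (p x) + ennreal ((1 - \<epsilon>) * f x - p x)"
      using \<epsilon> nonneg[of x] by (simp add: u_def ennreal_plus_if)
    finally show ?thesis .
  qed
  show thesis
  proof (rule that[OF Q])
    fix g :: "real \<Rightarrow> ennreal"
    assume [measurable]: "g \<in> borel_measurable borel" and g1: "\<And>x. g x \<le> 1"
    have "(\<integral>\<^sup>+x. g x \<partial>mixture \<epsilon> (density lborel f) Q) = (\<integral>\<^sup>+x. m x * g x \<partial>lborel)"
      unfolding mix by (rule nn_integral_density_lborel) measurable
    also have "\<dots> \<le> (\<integral>\<^sup>+x. p x * g x + ennreal ((1 - \<epsilon>) * f x - p x) \<partial>lborel)"
    proof (intro nn_integral_mono)
      fix x
      have "m x * g x \<le> ennreal (p x) * g x + ennreal ((1 - \<epsilon>) * f x - p x) * g x"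
        using mult_right_mono[OF m_le[of x], of "g x"] by (simp add: distrib_right)
      also have "\<dots> \<le> ennreal (p x) * g x + ennreal ((1 - \<epsilon>) * f x - p x) * 1"
        by (intro add_left_mono mult_left_mono g1) simp
      finally show "m x * g x \<le> ennreal (p x) * g x + ennreal ((1 - \<epsilon>) * f x - p x)"
        by simp
    qed
    also have "\<dots> = (\<integral>\<^sup>+x. g x \<partial>density lborel p) + (\<integral>\<^sup>+x. ennreal ((1 - \<epsilon>) * f x - p x) \<partial>lborel)"
      by (subst nn_integral_add) (simp_all add: nn_integral_density_lborel)
    finally show "(\<integral>\<^sup>+x. g x \<partial>mixture \<epsilon> (density lborel f) Q) \<le>
      (\<integral>\<^sup>+x. g x \<partial>density lborel p) + (\<integral>\<^sup>+x. ennreal ((1 - \<epsilon>) * f x - p x) \<partial>lborel)" .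
  qed
qed

section \<open>Uncontaminated normal data\<close>

lemma nn_integral_normal_density:
  assumes "0 < \<sigma>"
  shows "(\<integral>\<^sup>+x. ennreal (normal_density \<mu> \<sigma> x) \<partial>lborel) = 1"
  using prob_space.emeasure_space_1[OF prob_space_normal_density[OF assms, of \<mu>]]
  by (simp add: emeasure_density)

lemma mixture_same:
  assumes "P \<in> prob_dists" "0 \<le> \<epsilon>" "\<epsilon> \<le> 1"
  shows "mixture \<epsilon> P P = P"
proof (rule measure_eqI)
  show "sets (mixture \<epsilon> P P) = sets P"
    using assms by (simp add: sets_mixture prob_dists_iff)
  fix A assume "A \<in> sets (mixture \<epsilon> P P)"
  then have "emeasure (mixture \<epsilon> P P) A = (ennreal (1 - \<epsilon>) + ennreal \<epsilon>) * emeasure P A"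
    using assms by (simp add: emeasure_mixture sets_mixture distrib_right)
  then show "emeasure (mixture \<epsilon> P P) A = emeasure P A"
    using assms by (simp flip: ennreal_plus)
qed

lemma return_0_convolution:
  assumes "P \<in> prob_dists"
  shows "(return borel 0 \<star> P) = P"
proof (rule measure_eqI)
  interpret P: prob_space P using assms by (simp add: prob_dists_iff)
  have sP: "sets P = sets borel" using assms by (simp add: prob_dists_iff)
  have fin: "finite_measure (return borel (0::real))"
    by (intro prob_space.finite_measure prob_space_return) simp
  show "sets (return borel 0 \<star> P) = sets P" using sP by simp
  fix A assume "A \<in> sets (return borel 0 \<star> P)"
  then have A[measurable]: "A \<in> sets borel" by simp
  have [measurable_cong]: "sets P = sets borel" by fact
  have "emeasure (return borel 0 \<star> P) A = (\<integral>\<^sup>+x. \<integral>\<^sup>+y. indicator A (x + y) \<partial>P \<partial>return borel 0)"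
    by (rule convolution_emeasure'[OF A fin P.finite_measure_axioms sP]) simp
  also have "\<dots> = (\<integral>\<^sup>+y. indicator A (0 + y) \<partial>P)"
    by (rule nn_integral_return) (simp, measurable)
  finally show "emeasure (return borel 0 \<star> P) A = emeasure P A"
    using A sP by simp
qed

text \<open>
  Contamination by a point mass at \<open>0\<close>, smeared by the noise, is the normal law itself. This is why
  the guarantee on the length at any level \<open>\<epsilon>\<close> speaks about clean normal data.
\<close>

lemma efron_point_mass:
  assumes "0 < \<sigma>" "0 \<le> \<epsilon>" "\<epsilon> \<le> 1"
  shows "efron 0 \<sigma> \<epsilon> (return borel 0) = normal 0 \<sigma>"
  using assms by (simp add: efron_def return_0_convolution normal_prob_dist mixture_same)

lemma huber_self:
  assumes "0 < \<sigma>" "0 \<le> \<epsilon>" "\<epsilon> \<le> 1"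
  shows "huber \<theta> \<sigma> \<epsilon> (normal \<theta> \<sigma>) = normal \<theta> \<sigma>"
  using assms by (simp add: huber_def normal_prob_dist mixture_same)

section \<open>The two-point argument\<close>

lemma diff_le_len:
  assumes "a \<in> I" "b \<in> I"
  shows "ereal (b - a) \<le> len I"
proof -
  have "ereal b - ereal a \<le> (SUP x\<in>I. ereal x) - (INF x\<in>I. ereal x)"
    using assms by (intro ereal_minus_mono SUP_upper INF_lower)
  then show ?thesis using assms by (auto simp: len_def)
qed

text \<open>
  The budget behind the constants: three events of probability at least \<open>1 - \<delta>\<close>, \<open>1 - \<delta>\<close> and
  \<open>1 - \<delta> - 1/4\<close> must intersect, which needs \<open>3 \<delta> + 1/4 < 1\<close>. Since an event of positive
  \<open>iid_prob\<close> is measurable, the union bound applies to the complements.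
\<close>

lemma iid_prob_three_events:
  assumes P: "P \<in> prob_dists" and \<delta>: "\<delta> < 1/4"
  assumes A: "ennreal (1 - \<delta>) \<le> iid_prob n P A"
    and B: "ennreal (1 - \<delta>) \<le> iid_prob n P B + ennreal (1/4)"
    and C: "ennreal (1 - \<delta>) \<le> iid_prob n P C"
  obtains x where "A x" "B x" "C x"
proof -
  let ?M = "Pi\<^sub>M {..<n} (\<lambda>_. P)"
  interpret M: prob_space ?M
    using P by (intro prob_space_PiM) (simp add: prob_dists_iff)
  let ?S = "\<lambda>E. {x \<in> space ?M. E x}"
  have meas: "?S E \<in> M.events" if "0 < iid_prob n P E" for E
    using that emeasure_notin_sets[of "?S E" ?M] unfolding iid_prob_def by fastforce
  have prob: "iid_prob n P E = ennreal (M.prob (?S E))" for E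
    by (simp add: iid_prob_def M.emeasure_eq_measure)
  have a: "1 - \<delta> \<le> M.prob (?S A)" and c: "1 - \<delta> \<le> M.prob (?S C)"
    using A C \<delta> by (simp_all add: prob)
  have b: "1 - \<delta> \<le> M.prob (?S B) + 1/4"
    using B by (simp add: prob ennreal_plus[symmetric] del: ennreal_plus)
  have mA: "?S A \<in> M.events" and mB: "?S B \<in> M.events" and mC: "?S C \<in> M.events"
    using a b c \<delta> by (auto intro!: meas simp: prob)
  have "M.prob (?S A) + M.prob (?S B) - 1 \<le> M.prob (?S A \<inter> ?S B)"
    using M.finite_measure_Union'[OF mA mB] M.finite_measure_Diff'[OF mB mA]
      M.prob_le_1[of "?S A \<union> ?S B"] by (simp add: Int_commute)
  moreover have "M.prob (?S A \<inter> ?S B) + M.prob (?S C) - 1 \<le> M.prob (?S A \<inter> ?S B \<inter> ?S C)"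
    using M.finite_measure_Union'[of "?S A \<inter> ?S B" "?S C"] M.finite_measure_Diff'[OF mC, of "?S A \<inter> ?S B"]
      mA mB mC M.prob_le_1[of "(?S A \<inter> ?S B) \<union> ?S C"] by (simp add: Int_commute)
  ultimately have "0 < M.prob (?S A \<inter> ?S B \<inter> ?S C)"
    using a b c \<delta> by linarith
  then have "?S A \<inter> ?S B \<inter> ?S C \<noteq> {}" by force
  then show thesis using that by auto
qed

lemma confidence_length_ge:
  assumes \<delta>: "\<delta> < 1/4" and \<sigma>: "0 < \<sigma>" and s: "0 < s" and \<epsilon>: "0 < \<epsilon>" "\<epsilon> < 1"
  assumes cover_0: "ennreal (1 - \<delta>) \<le> iid_prob n (normal 0 \<sigma>) (\<lambda>x. 0 \<in> C x)"
    and cover_\<theta>: "\<And>Q. Q \<in> prob_dists \<Longrightarrow> ennreal (1 - \<delta>) \<le> iid_prob n (huber \<theta> s \<epsilon> Q) (\<lambda>x. \<theta> \<in> C x)"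
    and short: "ennreal (1 - \<delta>) \<le> iid_prob n (normal 0 \<sigma>) (\<lambda>x. len (C x) \<le> R)"
    and error: "of_nat n * (\<integral>\<^sup>+x. ennreal ((1 - \<epsilon>) * normal_density \<theta> s x - normal_density 0 \<sigma> x) \<partial>lborel)
      \<le> ennreal (1/4)"
  shows "ereal \<theta> \<le> R"
proof -
  obtain Q where Q: "Q \<in> prob_dists" and
    dom: "\<And>g. g \<in> borel_measurable borel \<Longrightarrow> (\<And>x. g x \<le> 1) \<Longrightarrow>
      (\<integral>\<^sup>+x. g x \<partial>huber \<theta> s \<epsilon> Q) \<le> (\<integral>\<^sup>+x. g x \<partial>normal 0 \<sigma>) +
      (\<integral>\<^sup>+x. ennreal ((1 - \<epsilon>) * normal_density \<theta> s x - normal_density 0 \<sigma> x) \<partial>lborel)"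
    using exists_contamination[of "normal_density \<theta> s" "normal_density 0 \<sigma>" \<epsilon>] s \<sigma> \<epsilon>
    unfolding huber_def normal_def by (auto simp: nn_integral_normal_density)
  have "huber \<theta> s \<epsilon> Q \<in> prob_dists" "normal 0 \<sigma> \<in> prob_dists"
    using Q s \<sigma> \<epsilon> by (auto intro!: huber_prob_dist normal_prob_dist)
  from order_trans[OF cover_\<theta>[OF Q] iid_prob_le_add[OF this dom]]
  have "ennreal (1 - \<delta>) \<le> iid_prob n (normal 0 \<sigma>) (\<lambda>x. \<theta> \<in> C x) + ennreal (1/4)"
    using error by (meson add_left_mono order_trans)
  then obtain x where "0 \<in> C x" "\<theta> \<in> C x" "len (C x) \<le> R"
    using iid_prob_three_events[OF normal_prob_dist[OF \<sigma>] \<delta> cover_0 _ short] by blast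
  then show ?thesis
    using diff_le_len[of 0 "C x" \<theta>] by simp
qed

section \<open>Comparing normal densities\<close>

text \<open>
  Take \<open>\<sigma> = 1\<close>. Since \<open>s < 1\<close>, completing the square in the log-likelihood ratio gives the constant
  \<open>\<theta>\<^sup>2 / (2 (1-s\<^sup>2)) - ln s\<close> minus a square. The hypothesis on \<open>\<theta>\<close> says that this constant is at
  most \<open>- ln (1-\<epsilon>)\<close>.
\<close>

lemma narrow_normal_density_le:
  fixes s \<theta> \<sigma> \<epsilon> :: real
  assumes \<sigma>: "0 < \<sigma>" and s: "0 < s" "s < 1" and \<epsilon>: "0 < \<epsilon>" "\<epsilon> < 1"
  assumes \<theta>: "\<theta>\<^sup>2 \<le> 2 * (1 - s\<^sup>2) * ln (s / (1 - \<epsilon>))"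
  shows "(1 - \<epsilon>) * normal_density (\<theta> * \<sigma>) (s * \<sigma>) x \<le> normal_density 0 \<sigma> x"
proof -
  define y where "y = x / \<sigma>"
  have x: "x = y * \<sigma>" using \<sigma> by (simp add: y_def)
  have s2: "0 < 1 - s\<^sup>2" using s by (simp add: power_less_one_iff abs_square_less_1)
  have square: "(y - \<theta>)\<^sup>2 / s\<^sup>2 - y\<^sup>2 + \<theta>\<^sup>2 / (1 - s\<^sup>2) = ((1 - s\<^sup>2) * y - \<theta>)\<^sup>2 / (s\<^sup>2 * (1 - s\<^sup>2))"
  proof -
    have "s\<^sup>2 \<noteq> 0" "1 - s\<^sup>2 \<noteq> 0" using s s2 by auto
    then show ?thesis
      by (simp add: divide_simps) (simp add: algebra_simps power2_eq_square)
  qed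
  have "0 \<le> (y - \<theta>)\<^sup>2 / s\<^sup>2 - y\<^sup>2 + \<theta>\<^sup>2 / (1 - s\<^sup>2)"
    unfolding square using s2 by simp
  moreover have "\<theta>\<^sup>2 / (1 - s\<^sup>2) \<le> 2 * ln (s / (1 - \<epsilon>))"
    using \<theta> s2 by (simp add: field_simps)
  moreover have "(y - \<theta>)\<^sup>2 / (2 * s\<^sup>2) = ((y - \<theta>)\<^sup>2 / s\<^sup>2) / 2" by simp
  moreover have "ln (s / (1 - \<epsilon>)) = ln s - ln (1 - \<epsilon>)"
    using s \<epsilon> by (simp add: ln_div)
  ultimately have log_le: "ln (1 - \<epsilon>) - ln s + - (y - \<theta>)\<^sup>2 / (2 * s\<^sup>2) \<le> - y\<^sup>2 / 2"
    by linarith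
  have "(1 - \<epsilon>) / s * exp (- (y - \<theta>)\<^sup>2 / (2 * s\<^sup>2)) =
      exp (ln (1 - \<epsilon>) - ln s + - (y - \<theta>)\<^sup>2 / (2 * s\<^sup>2))"
    unfolding exp_add exp_diff using s \<epsilon> by simp
  also have "\<dots> \<le> exp (- y\<^sup>2 / 2)"
    using log_le unfolding exp_le_cancel_iff .
  finally have le: "(1 - \<epsilon>) / s * exp (- (y - \<theta>)\<^sup>2 / (2 * s\<^sup>2)) \<le> exp (- y\<^sup>2 / 2)" .
  have expo: "(x - \<theta> * \<sigma>)\<^sup>2 / (2 * (s * \<sigma>)\<^sup>2) = (y - \<theta>)\<^sup>2 / (2 * s\<^sup>2)"
      "x\<^sup>2 / (2 * \<sigma>\<^sup>2) = y\<^sup>2 / 2"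
    using \<sigma> s by (simp_all add: x power_mult_distrib flip: left_diff_distrib)
  have root: "sqrt (2 * pi * (s * \<sigma>)\<^sup>2) = sqrt (2 * pi * \<sigma>\<^sup>2) * s"
    using s by (simp add: power_mult_distrib real_sqrt_mult)
  show ?thesis
    using mult_left_mono[OF le, of "1 / sqrt (2 * pi * \<sigma>\<^sup>2)"]
    by (simp add: normal_density_def expo root)
qed

text \<open>
  The Chernoff bound, before integration. Where the left side is positive, the likelihood ratio
  \<open>exp u\<close> of the two normal laws exceeds \<open>exp L\<close>, so inserting the factor \<open>exp (k (u - L))\<close>
  does not decrease it. Tilting \<open>N(h,\<sigma>\<^sup>2)\<close> by \<open>exp (k u)\<close> gives a multiple of \<open>N((1+k) h,\<sigma>\<^sup>2)\<close>.
\<close>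

lemma shift_excess_le:
  fixes h k L \<sigma> x :: real
  assumes \<sigma>: "0 < \<sigma>" and k: "0 \<le> k" and L: "0 \<le> L"
  shows "exp (- L) * normal_density h \<sigma> x - normal_density 0 \<sigma> x
    \<le> exp ((k\<^sup>2 + k) * h\<^sup>2 / (2 * \<sigma>\<^sup>2) - k * L) * normal_density ((1 + k) * h) \<sigma> x"
proof -
  define u where "u = (x * h - h\<^sup>2 / 2) / \<sigma>\<^sup>2"
  define p where "p = normal_density 0 \<sigma> x"
  have p: "0 \<le> p" by (simp add: p_def)
  have e1: "- (x - h)\<^sup>2 / (2 * \<sigma>\<^sup>2) = - x\<^sup>2 / (2 * \<sigma>\<^sup>2) + u"
    using \<sigma> by (simp add: u_def divide_simps) (simp add: algebra_simps power2_eq_square)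
  have e2: "(k\<^sup>2 + k) * h\<^sup>2 / (2 * \<sigma>\<^sup>2) - k * L + - (x - (1 + k) * h)\<^sup>2 / (2 * \<sigma>\<^sup>2)
      = - x\<^sup>2 / (2 * \<sigma>\<^sup>2) + (u + k * (u - L))"
    using \<sigma> by (simp add: u_def divide_simps) (simp add: algebra_simps power2_eq_square)
  have f: "normal_density h \<sigma> x = p * exp u"
    using arg_cong[OF e1, of exp] unfolding p_def normal_density_def exp_add by simp
  have tilt: "exp ((k\<^sup>2 + k) * h\<^sup>2 / (2 * \<sigma>\<^sup>2) - k * L) * normal_density ((1 + k) * h) \<sigma> x
      = p * exp (u + k * (u - L))"
    using arg_cong[OF e2, of exp]
    unfolding p_def normal_density_def exp_add by simp
  have "exp (u - L) - 1 \<le> exp (u + k * (u - L))"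
  proof (cases "u \<le> L")
    case True
    then have "exp (u - L) \<le> 1" by simp
    then show ?thesis using exp_gt_zero[of "u + k * (u - L)"] by linarith
  next
    case False
    then have "0 \<le> k * (u - L)" using k by simp
    then have "exp (u - L) \<le> exp (u + k * (u - L))" using L by simp
    then show ?thesis by linarith
  qed
  from mult_left_mono[OF this p] show ?thesis
    unfolding tilt f p_def[symmetric] by (simp add: algebra_simps exp_diff exp_minus divide_inverse)
qed

lemma nn_integral_shift_excess_le:
  fixes h k L \<sigma> :: real
  assumes "0 < \<sigma>" "0 \<le> k" "0 \<le> L"
  shows "(\<integral>\<^sup>+x. ennreal (exp (- L) * normal_density h \<sigma> x - normal_density 0 \<sigma> x) \<partial>lborel)
    \<le> ennreal (exp ((k\<^sup>2 + k) * h\<^sup>2 / (2 * \<sigma>\<^sup>2) - k * L))"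
proof -
  let ?c = "exp ((k\<^sup>2 + k) * h\<^sup>2 / (2 * \<sigma>\<^sup>2) - k * L)"
  have "(\<integral>\<^sup>+x. ennreal (exp (- L) * normal_density h \<sigma> x - normal_density 0 \<sigma> x) \<partial>lborel)
    \<le> (\<integral>\<^sup>+x. ennreal ?c * ennreal (normal_density ((1 + k) * h) \<sigma> x) \<partial>lborel)"
    using shift_excess_le[OF assms]
    by (intro nn_integral_mono) (simp add: ennreal_mult[symmetric] ennreal_leI)
  also have "\<dots> = ennreal ?c"
    using assms by (simp add: nn_integral_cmult nn_integral_normal_density)
  finally show ?thesis .
qed

text \<open>
  The exponent \<open>k = a * ln n\<close> with \<open>a = 5 / L\<close> makes \<open>exp (- k L) = n powr -5\<close>. The shift is chosen
  so small that the factor \<open>exp ((k\<^sup>2 + k) h\<^sup>2 / (2 \<sigma>\<^sup>2))\<close> costs at most two powers of \<open>n\<close>; a bound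
  \<open>n * n powr -3 \<le> 1/4\<close> is left.
\<close>

lemma log_shift_error:
  fixes L \<sigma> :: real
  assumes n: "2 \<le> n" and L: "0 < L" and \<sigma>: "0 < \<sigma>"
  defines "h \<equiv> \<sigma> * (1 / (1 + 5 / L)) / sqrt (ln (real n))"
  shows "of_nat n * (\<integral>\<^sup>+x. ennreal (exp (- L) * normal_density h \<sigma> x - normal_density 0 \<sigma> x) \<partial>lborel)
    \<le> ennreal (1/4)"
proof -
  define a where "a = 5 / L"
  define c where "c = 1 / (1 + a)"
  define l where "l = ln (real n)"
  have a: "0 < a" "a * L = 5" using L by (simp_all add: a_def)
  have n0: "0 < real n" using n by simp
  have "1/2 \<le> ln (2::real)"
    using ln_le_minus_one[of "1/2"] by (simp add: ln_div)
  also have "ln 2 \<le> l" unfolding l_def using n by (intro ln_mono) auto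
  finally have l: "1/2 \<le> l" .
  have c: "0 < c" "a * c \<le> 1" "c \<le> 1" using a by (simp_all add: c_def field_simps)
  have ac2: "(a * c)\<^sup>2 \<le> 1" using c a by (simp add: power_le_one)
  have "a * c * c \<le> 1 * 1" using c a by (intro mult_mono) auto
  then have acc: "a * c\<^sup>2 \<le> 1" by (simp add: power2_eq_square mult.assoc)
  have "h\<^sup>2 = \<sigma>\<^sup>2 * c\<^sup>2 / l"
    using l unfolding h_def a_def[symmetric] c_def[symmetric] l_def[symmetric]
    by (simp add: power_mult_distrib power_divide)
  then have "((a * l)\<^sup>2 + a * l) * h\<^sup>2 / (2 * \<sigma>\<^sup>2) - (a * l) * L = (a * c)\<^sup>2 * l / 2 + a * c\<^sup>2 / 2 - 5 * l"
    using \<sigma> l a by (simp add: divide_simps) (simp add: algebra_simps power2_eq_square)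
  also have "\<dots> \<le> - 3 * l"
    using mult_right_mono[OF ac2, of l] acc l by linarith
  finally have expo: "((a * l)\<^sup>2 + a * l) * h\<^sup>2 / (2 * \<sigma>\<^sup>2) - (a * l) * L \<le> - 3 * l" .
  have "(\<integral>\<^sup>+x. ennreal (exp (- L) * normal_density h \<sigma> x - normal_density 0 \<sigma> x) \<partial>lborel)
      \<le> ennreal (exp (((a * l)\<^sup>2 + a * l) * h\<^sup>2 / (2 * \<sigma>\<^sup>2) - (a * l) * L))"
    using a l L \<sigma> by (intro nn_integral_shift_excess_le) auto
  also have "\<dots> \<le> ennreal (exp (- 3 * l))"
    using expo by (intro ennreal_leI) simp
  also have "exp (- 3 * l) = 1 / real n ^ 3"
    using n0 exp_of_nat_mult[of 3 l] by (simp add: l_def exp_minus inverse_eq_divide)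
  finally have "of_nat n * (\<integral>\<^sup>+x. ennreal (exp (- L) * normal_density h \<sigma> x - normal_density 0 \<sigma> x) \<partial>lborel)
      \<le> ennreal (real n) * ennreal (1 / real n ^ 3)"
    by (intro mult_mono) (auto simp: ennreal_of_nat_eq_real_of_nat)
  also have "\<dots> = ennreal (1 / real n ^ 2)"
    using n0 by (simp add: ennreal_mult[symmetric] power2_eq_square power3_eq_cube)
  also have "\<dots> \<le> ennreal (1/4)"
  proof -
    have "2\<^sup>2 \<le> (real n)\<^sup>2" using n by (intro power_mono) auto
    then show ?thesis using n0 by (intro ennreal_leI) (simp add: field_simps)
  qed
  finally show ?thesis .
qed

section \<open>Lower bounds for adaptive confidence intervals\<close>

theorem theorem6:
  fixes \<delta> \<epsilon>max :: real
  assumes "0 < \<delta>" "\<delta> < 1/4" "0 < \<epsilon>max" "\<epsilon>max < 1/2"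
  shows "\<exists>c::real. c > 0 \<and>
    (\<forall>(CI :: nat \<Rightarrow> real \<Rightarrow> (nat \<Rightarrow> real) \<Rightarrow> real set) (r :: nat \<Rightarrow> real \<Rightarrow> real \<Rightarrow> ereal) n \<sigma>.
       n \<ge> 2 \<and> \<sigma> > 0 \<and> interval_estimator n (CI n \<sigma>) \<and>
       (INF \<theta>::real. INF (\<epsilon>, Q) \<in> {0..\<epsilon>max} \<times> prob_dists.
          iid_prob n (huber \<theta> \<sigma> \<epsilon> Q) (\<lambda>x. \<theta> \<in> CI n \<sigma> x)) \<ge> ennreal (1 - \<delta>) \<and>
       (INF \<theta>::real. INF (\<epsilon>, Q) \<in> {0..\<epsilon>max} \<times> prob_dists.
          iid_prob n (efron \<theta> \<sigma> \<epsilon> Q) (\<lambda>x. len (CI n \<sigma> x) \<le> r n \<sigma> \<epsilon>)) \<ge> ennreal (1 - \<delta>)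
       \<longrightarrow> (\<forall>\<epsilon>\<in>{0..\<epsilon>max}. r n \<sigma> \<epsilon> \<ge> ereal (c * \<sigma> / sqrt (ln (real n))))) \<and>
    (\<forall>(CI :: nat \<Rightarrow> (nat \<Rightarrow> real) \<Rightarrow> real set) (r :: nat \<Rightarrow> real \<Rightarrow> real \<Rightarrow> ereal) n.
       interval_estimator n (CI n) \<and>
       (INF (\<theta>::real, \<sigma>) \<in> UNIV \<times> {0<..}. INF (\<epsilon>, Q) \<in> {0..\<epsilon>max} \<times> prob_dists.
          iid_prob n (huber \<theta> \<sigma> \<epsilon> Q) (\<lambda>x. \<theta> \<in> CI n x)) \<ge> ennreal (1 - \<delta>) \<and>
       (INF (\<theta>::real, \<sigma>) \<in> UNIV \<times> {0<..}. INF (\<epsilon>, Q) \<in> {0..\<epsilon>max} \<times> prob_dists.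
          iid_prob n (efron \<theta> \<sigma> \<epsilon> Q) (\<lambda>x. len (CI n x) \<le> r n \<sigma> \<epsilon>)) \<ge> ennreal (1 - \<delta>)
       \<longrightarrow> (\<forall>\<sigma>>0. \<forall>\<epsilon>\<in>{0..\<epsilon>max}. r n \<sigma> \<epsilon> \<ge> ereal (c * \<sigma>)))"
proof -
  have \<epsilon>max: "0 \<le> \<epsilon>max" "\<epsilon>max \<le> 1" "\<epsilon>max < 1" using assms by auto
  define L where "L = - ln (1 - \<epsilon>max)"
  have L: "0 < L" "exp (- L) = 1 - \<epsilon>max" using assms by (simp_all add: L_def)
  define c1 where "c1 = 1 / (1 + 5 / L)"
  have c1: "0 < c1" using L by (simp add: c1_def add_pos_pos)
  \<comment> \<open>Any \<open>s\<close> strictly between \<open>1 - \<epsilon>max\<close> and \<open>1\<close> would do.\<close>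
  define s where "s = 1 - \<epsilon>max / 2"
  have s: "0 < s" "s < 1" "1 < s / (1 - \<epsilon>max)" using assms by (simp_all add: s_def field_simps)
  define K where "K = 2 * (1 - s\<^sup>2) * ln (s / (1 - \<epsilon>max))"
  have "0 < 1 - s\<^sup>2" using s by (simp add: abs_square_less_1)
  then have K: "0 < K" using s by (simp add: K_def)
  define c2 where "c2 = sqrt K"
  have c2: "0 < c2" "c2\<^sup>2 = K" using K by (simp_all add: c2_def)
  have dirac: "return borel 0 \<in> prob_dists"
    by (simp add: prob_dists_iff prob_space_return)
  have known: "r n \<sigma> \<epsilon> \<ge> ereal (min c1 c2 * \<sigma> / sqrt (ln (real n)))"
    if n: "n \<ge> 2" and \<sigma>: "\<sigma> > 0" and \<epsilon>: "\<epsilon> \<in> {0..\<epsilon>max}"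
      and cov: "(INF \<theta>::real. INF (\<epsilon>, Q) \<in> {0..\<epsilon>max} \<times> prob_dists.
          iid_prob n (huber \<theta> \<sigma> \<epsilon> Q) (\<lambda>x. \<theta> \<in> CI n \<sigma> x)) \<ge> ennreal (1 - \<delta>)"
      and short: "(INF \<theta>::real. INF (\<epsilon>, Q) \<in> {0..\<epsilon>max} \<times> prob_dists.
          iid_prob n (efron \<theta> \<sigma> \<epsilon> Q) (\<lambda>x. len (CI n \<sigma> x) \<le> r n \<sigma> \<epsilon>)) \<ge> ennreal (1 - \<delta>)"
    for CI :: "nat \<Rightarrow> real \<Rightarrow> (nat \<Rightarrow> real) \<Rightarrow> real set" and r :: "nat \<Rightarrow> real \<Rightarrow> real \<Rightarrow> ereal"
      and n \<sigma> \<epsilon>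
  proof -
    have C: "ennreal (1 - \<delta>) \<le> iid_prob n (huber \<theta> \<sigma> \<epsilon>max Q) (\<lambda>x. \<theta> \<in> CI n \<sigma> x)"
      if "Q \<in> prob_dists" for \<theta> Q
      using cov that \<epsilon>max by (auto simp: le_INF_iff)
    have E: "ennreal (1 - \<delta>) \<le> iid_prob n (efron 0 \<sigma> \<epsilon> (return borel 0)) (\<lambda>x. len (CI n \<sigma> x) \<le> r n \<sigma> \<epsilon>)"
      using short dirac \<epsilon> by (auto simp: le_INF_iff)
    have "ereal (\<sigma> * c1 / sqrt (ln (real n))) \<le> r n \<sigma> \<epsilon>"
    proof (rule confidence_length_ge[OF assms(2) \<sigma> \<sigma> assms(3) \<epsilon>max(3) _ C])
      show "ennreal (1 - \<delta>) \<le> iid_prob n (normal 0 \<sigma>) (\<lambda>x. 0 \<in> CI n \<sigma> x)"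
        using C[OF normal_prob_dist[OF \<sigma>], of 0 0] \<sigma> \<epsilon>max by (simp add: huber_self)
      show "ennreal (1 - \<delta>) \<le> iid_prob n (normal 0 \<sigma>) (\<lambda>x. len (CI n \<sigma> x) \<le> r n \<sigma> \<epsilon>)"
        using E \<sigma> \<epsilon> \<epsilon>max by (simp add: efron_point_mass)
      show "of_nat n * (\<integral>\<^sup>+x. ennreal ((1 - \<epsilon>max) * normal_density (\<sigma> * c1 / sqrt (ln (real n))) \<sigma> x
          - normal_density 0 \<sigma> x) \<partial>lborel) \<le> ennreal (1/4)"
        using log_shift_error[OF n L(1) \<sigma>] unfolding c1_def[symmetric] L(2) .
    qed
    moreover have "min c1 c2 * \<sigma> / sqrt (ln (real n)) \<le> \<sigma> * c1 / sqrt (ln (real n))"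
      using n \<sigma> by (intro divide_right_mono) (auto simp: mult.commute)
    ultimately show ?thesis
      by (meson ereal_less_eq(3) order_trans)
  qed
  have unknown: "r n \<sigma> \<epsilon> \<ge> ereal (min c1 c2 * \<sigma>)"
    if \<sigma>: "\<sigma> > 0" and \<epsilon>: "\<epsilon> \<in> {0..\<epsilon>max}"
      and cov: "(INF (\<theta>::real, \<sigma>) \<in> UNIV \<times> {0<..}. INF (\<epsilon>, Q) \<in> {0..\<epsilon>max} \<times> prob_dists.
          iid_prob n (huber \<theta> \<sigma> \<epsilon> Q) (\<lambda>x. \<theta> \<in> CI n x)) \<ge> ennreal (1 - \<delta>)"
      and short: "(INF (\<theta>::real, \<sigma>) \<in> UNIV \<times> {0<..}. INF (\<epsilon>, Q) \<in> {0..\<epsilon>max} \<times> prob_dists.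
          iid_prob n (efron \<theta> \<sigma> \<epsilon> Q) (\<lambda>x. len (CI n x) \<le> r n \<sigma> \<epsilon>)) \<ge> ennreal (1 - \<delta>)"
    for CI :: "nat \<Rightarrow> (nat \<Rightarrow> real) \<Rightarrow> real set" and r :: "nat \<Rightarrow> real \<Rightarrow> real \<Rightarrow> ereal"
      and n \<sigma> \<epsilon>
  proof -
    have C: "ennreal (1 - \<delta>) \<le> iid_prob n (huber \<theta> t \<epsilon>max Q) (\<lambda>x. \<theta> \<in> CI n x)"
      if "Q \<in> prob_dists" "0 < t" for \<theta> t Q
      using cov that \<epsilon>max by (auto simp: le_INF_iff)
    have E: "ennreal (1 - \<delta>) \<le> iid_prob n (efron 0 \<sigma> \<epsilon> (return borel 0)) (\<lambda>x. len (CI n x) \<le> r n \<sigma> \<epsilon>)"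
      using short dirac \<epsilon> \<sigma> by (auto simp: le_INF_iff)
    have s\<sigma>: "0 < s * \<sigma>" using s \<sigma> by simp
    have "ereal (c2 * \<sigma>) \<le> r n \<sigma> \<epsilon>"
    proof (rule confidence_length_ge[OF assms(2) \<sigma> s\<sigma> assms(3) \<epsilon>max(3) _ C[OF _ s\<sigma>]])
      show "ennreal (1 - \<delta>) \<le> iid_prob n (normal 0 \<sigma>) (\<lambda>x. 0 \<in> CI n x)"
        using C[OF normal_prob_dist[OF \<sigma>] \<sigma>, of 0 0] \<sigma> \<epsilon>max by (simp add: huber_self)
      show "ennreal (1 - \<delta>) \<le> iid_prob n (normal 0 \<sigma>) (\<lambda>x. len (CI n x) \<le> r n \<sigma> \<epsilon>)"
        using E \<sigma> \<epsilon> \<epsilon>max by (simp add: efron_point_mass)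
      have "(1 - \<epsilon>max) * normal_density (c2 * \<sigma>) (s * \<sigma>) x - normal_density 0 \<sigma> x \<le> 0" for x
        using narrow_normal_density_le[OF \<sigma> s(1,2) assms(3) \<epsilon>max(3), of c2 x] c2 by (simp add: K_def)
      then show "of_nat n * (\<integral>\<^sup>+x. ennreal ((1 - \<epsilon>max) * normal_density (c2 * \<sigma>) (s * \<sigma>) x
          - normal_density 0 \<sigma> x) \<partial>lborel) \<le> ennreal (1/4)"
        by (simp add: ennreal_neg)
    qed
    moreover have "min c1 c2 * \<sigma> \<le> c2 * \<sigma>"
      using \<sigma> by (intro mult_right_mono) auto
    ultimately show ?thesis
      by (meson ereal_less_eq(3) order_trans)
  qed
  show ?thesis
    using c1 c2 known unknown by (intro exI[of _ "min c1 c2"]) (auto simp only: min_less_iff_conj)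
qed

end
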